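(* Let $G$ be an Abelian group and $S$ a subsemigroup of $G$ with $0\in S$. The following statements are equivalent: (1) every sequence in $G_S$ is convergent; (2) for each cardinal $\kappa$ the power $G_S^\kappa$ of the space $G_S$ is sequentially compact; (3) the power $G_S^{\mathfrak c}$ is sequentially compact; (4) each countable subset $C\subseteq G$ is contained in $a-S$ for some $a\in S$; (5) $G=S-S$ and each countable subset $C\subseteq S$ is contained in $a-S$ for some $a\in S$; (6) $G=S-S$ and each infinite subset $C\subseteq S$ has infinite intersection with the set $a-S$ for some $a\in S$; (7) $G=S-S$ and each infinite subset $C\subseteq G$ has infinite intersection with the set $a-S$ for some $a\in G$.
   Context: For an Abelian group $G$ (written additively) and a subsemigroup $S\ni 0$ of $G$, $G_S$ denotes the group $G$ endowed with the topology consisting of all sets $A+S$ with $A\subseteq G$. Here $S-S=\{s-t:s,t\in S\}$, $a-S=\{a-s:s\in S\}$, and $\mathfrak c$ is the cardinality of the continuum. Powers carry the Tychonoff product topology. A space is sequentially compact if each sequence in it has a convergent subsequence. No separation axioms are assumed. *)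

theory Defs
  imports "HOL-Analysis.Analysis"
begin

definition add_subsemigroup :: "'a::ab_group_add set \<Rightarrow> bool" where
  "add_subsemigroup S \<longleftrightarrow> (\<forall>s\<in>S. \<forall>t\<in>S. s + t \<in> S)"

text \<open>Binary minus on sets is set difference, so the algebraic difference needs its own
  constants; the sum \<open>A + S\<close> of sets is the library's elementwise sum.\<close>

definition set_diff_alg :: "'a::ab_group_add set \<Rightarrow> 'a set \<Rightarrow> 'a set" where
  "set_diff_alg A B = {s - t |s t. s \<in> A \<and> t \<in> B}"

definition elt_diff_alg :: "'a::ab_group_add \<Rightarrow> 'a set \<Rightarrow> 'a set" where
  "elt_diff_alg a B = {a - s |s. s \<in> B}"

definition semigroup_topology :: "'a::ab_group_add set \<Rightarrow> 'a topology" where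
  "semigroup_topology S = topology (\<lambda>U. \<exists>A. U = A + S)"

text \<open>The function \<open>topology\<close> is meaningful only on predicates satisfying \<open>istopology\<close>,
  which is where closure of \<open>S\<close> under addition and \<open>0 \<in> S\<close> are used.\<close>

lemma istopology_semigroup:
  fixes S :: "'a::ab_group_add set"
  assumes S: "add_subsemigroup S" and zero: "0 \<in> S"
  shows "istopology (\<lambda>U. \<exists>A. U = A + S)"
proof -
  have iff: "(\<exists>A. U = A + S) \<longleftrightarrow> (\<forall>u\<in>U. \<forall>s\<in>S. u + s \<in> U)" for U :: "'a set"
  proof
    assume "\<exists>A. U = A + S"
    then obtain A where U: "U = A + S" by blast
    show "\<forall>u\<in>U. \<forall>s\<in>S. u + s \<in> U"
      using S unfolding U set_plus_def add_subsemigroup_def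
      by (simp add: add.assoc) (metis add.assoc)
  next
    assume *: "\<forall>u\<in>U. \<forall>s\<in>S. u + s \<in> U"
    have "U = U + S"
    proof
      show "U \<subseteq> U + S"
        using set_plus_intro[OF _ zero] by fastforce
      show "U + S \<subseteq> U"
        using * by (auto simp: set_plus_def)
    qed
    then show "\<exists>A. U = A + S" by blast
  qed
  show ?thesis
    unfolding istopology_def iff by blast
qed

lemma openin_semigroup_topology:
  assumes "add_subsemigroup S" "0 \<in> S"
  shows "openin (semigroup_topology S) U \<longleftrightarrow> (\<exists>A. U = A + S)"
  using istopology_semigroup[OF assms] by (simp add: semigroup_topology_def topology_inverse')

lemma topspace_semigroup_topology:
  fixes S :: "'a::ab_group_add set"
  assumes "add_subsemigroup S" "0 \<in> S"
  shows "topspace (semigroup_topology S) = UNIV"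
proof -
  have "(UNIV :: 'a set) = UNIV + S"
    using set_plus_intro[OF UNIV_I assms(2)] by fastforce
  then have "openin (semigroup_topology S) UNIV"
    using openin_semigroup_topology[OF assms] by blast
  then show ?thesis
    using openin_subset by blast
qed

text \<open>The library's \<open>convergent\<close> and \<open>seq_compact\<close> refer to a type-class topology; these are
  the same notions for a topology given as a value. Limits need not be unique.\<close>

definition convergent_in :: "'a topology \<Rightarrow> (nat \<Rightarrow> 'a) \<Rightarrow> bool" where
  "convergent_in X x \<longleftrightarrow> (\<exists>l. limitin X x l sequentially)"

definition sequentially_compact_space :: "'a topology \<Rightarrow> bool" where
  "sequentially_compact_space X \<longleftrightarrow>
     (\<forall>x :: nat \<Rightarrow> 'a. range x \<subseteq> topspace X \<longrightarrow>
        (\<exists>r :: nat \<Rightarrow> nat. strict_mono r \<and> convergent_in X (x \<circ> r)))"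

text \<open>The power of \<open>X\<close> with exponent \<open>I\<close>. A cardinal is represented by an index set of that
  cardinality. HOL cannot quantify over all sets inside a formula; ``for each cardinal'' is
  rendered as ``for each subset \<open>I\<close> of the type \<open>'i + real\<close>'', where \<open>'i\<close> is a free
  (hence universally quantified) type variable of the theorem. The summand \<open>real\<close> only makes sure
  that the cardinals in question always include that of the continuum.\<close>

definition power_topology :: "'a topology \<Rightarrow> 'i set \<Rightarrow> ('i \<Rightarrow> 'a) topology" where
  "power_topology X I = product_topology (\<lambda>_. X) I"

definition all_equivalent :: "bool list \<Rightarrow> bool" where
  "all_equivalent Ps \<longleftrightarrow> (\<forall>P\<in>set Ps. \<forall>Q\<in>set Ps. P \<longleftrightarrow> Q)"

end

theory Submission
  imports Defs
begin

text \<open>The smallest open neighbourhood of \<open>l\<close> in \<open>G\<^sub>S\<close> is \<open>l + S\<close>, so \<open>x\<close> converges to \<open>l\<close> iff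
  eventually \<open>-l - (-x\<^sub>n) \<in> S\<close>; replacing \<open>x\<close> by \<open>-x\<close> turns convergence of all sequences into (4).
  For (7) \<open>\<Longrightarrow>\<close> (4) one applies (7) to the partial sums \<open>d\<^sub>n\<close> of an enumeration of a countable subset of
  \<open>S\<close>: if \<open>a - d\<^sub>n \<in> S\<close> then \<open>a - c\<^sub>i \<in> S\<close> for all \<open>i \<le> n\<close>. For (3) \<open>\<Longrightarrow>\<close> (1) the coordinates of the
  power are indexed by the subsets of \<open>\<nat>\<close>, and a sequence \<open>x\<close> is spread over the coordinate \<open>A\<close> so that
  its restriction to \<open>A\<close>, listed increasingly, is \<open>x\<close> itself; a convergent subsequence of the
  resulting sequence then forces \<open>x\<close> to converge.\<close>

section \<open>Convergent sequences and bounds for countable sets\<close>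

lemma mem_elt_diff_alg [simp]:
  fixes a c :: "'a::ab_group_add"
  shows "c \<in> elt_diff_alg a S \<longleftrightarrow> a - c \<in> S"
proof -
  have "c \<in> elt_diff_alg a S" if "a - c \<in> S"
    unfolding elt_diff_alg_def using that by (auto intro!: exI[of _ "a - c"])
  then show ?thesis
    by (auto simp: elt_diff_alg_def)
qed

lemma limitin_semigroup_topology_iff:
  fixes S :: "'a::ab_group_add set"
  assumes S: "add_subsemigroup S" "0 \<in> S"
  shows "limitin (semigroup_topology S) x l F \<longleftrightarrow> (\<forall>\<^sub>F n in F. x n - l \<in> S)"
proof
  have "openin (semigroup_topology S) ({l} + S)" "l \<in> {l} + S"
    using S by (auto simp: openin_semigroup_topology set_plus_def)
  moreover assume "limitin (semigroup_topology S) x l F"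
  ultimately have "\<forall>\<^sub>F n in F. x n \<in> {l} + S"
    by (auto simp: limitin_def)
  then show "\<forall>\<^sub>F n in F. x n - l \<in> S"
    by (rule eventually_mono) (auto simp: set_plus_def)
next
  assume ev: "\<forall>\<^sub>F n in F. x n - l \<in> S"
  have "\<forall>\<^sub>F n in F. x n \<in> A + S" if l: "l \<in> A + S" for A
  proof -
    obtain b s where b: "b \<in> A" and s: "s \<in> S" and l_eq: "l = b + s"
      using l by (auto elim: set_plus_elim)
    from ev show ?thesis
    proof (rule eventually_mono)
      fix n assume "x n - l \<in> S"
      \<comment> \<open>This sum is \<open>x n - b\<close>, since \<open>l = b + s\<close>.\<close>
      then have "s + (x n - l) \<in> S"
        using S s by (auto simp: add_subsemigroup_def)
      then have "b + (s + (x n - l)) \<in> A + S"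
        using b by (rule set_plus_intro[rotated])
      then show "x n \<in> A + S"
        by (simp add: l_eq)
    qed
  qed
  then show "limitin (semigroup_topology S) x l F"
    using S by (auto simp: limitin_def topspace_semigroup_topology openin_semigroup_topology)
qed

lemma all_convergent_imp_countable_bounded:
  fixes S :: "'a::ab_group_add set"
  assumes S: "add_subsemigroup S" "0 \<in> S"
    and conv: "\<forall>x :: nat \<Rightarrow> 'a. convergent_in (semigroup_topology S) x"
    and C: "countable C"
  shows "\<exists>a\<in>S. C \<subseteq> elt_diff_alg a S"
proof -
  let ?D = "insert 0 C"
  \<comment> \<open>The sequence \<open>c\<close> takes each value in \<open>?D\<close> infinitely often, so that eventual membership
    gives membership for all values; the value \<open>0\<close> puts the bound itself in \<open>S\<close>.\<close>
  define c where "c n = from_nat_into ?D (fst (prod_decode n))" for n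
  obtain l where "limitin (semigroup_topology S) (\<lambda>n. - c n) l sequentially"
    using conv unfolding convergent_in_def by blast
  then obtain N where N: "\<And>n. N \<le> n \<Longrightarrow> - c n - l \<in> S"
    using S by (auto simp: limitin_semigroup_topology_iff eventually_sequentially)
  have l: "- l - d \<in> S" if d: "d \<in> ?D" for d
  proof -
    obtain k where "from_nat_into ?D k = d"
      using from_nat_into_surj[of ?D d] C d by auto
    \<comment> \<open>The index \<open>prod_encode (k, N)\<close> is at least \<open>N\<close>, so
      the value \<open>d\<close> also occurs in the tail controlled by \<open>N\<close>.\<close>
    then have "c (prod_encode (k, N)) = d"
      by (simp add: c_def)
    then show ?thesis
      using N[of "prod_encode (k, N)"] le_prod_encode_2[of N k] minus_diff_commute[of d l] by simp
  qed
  show ?thesis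
  proof (intro bexI subsetI)
    show "- l \<in> S" using l[of 0] by simp
  qed (use l in auto)
qed

lemma countable_bounded_imp_convergent:
  fixes S :: "'a::ab_group_add set"
  assumes S: "add_subsemigroup S" "0 \<in> S"
    and bdd: "\<forall>C :: 'a set. countable C \<longrightarrow> (\<exists>a\<in>S. C \<subseteq> elt_diff_alg a S)"
  shows "convergent_in (semigroup_topology S) x"
proof -
  have "countable (range (\<lambda>n. - x n))"
    by simp
  then obtain a where "range (\<lambda>n. - x n) \<subseteq> elt_diff_alg a S"
    using bdd by blast
  then have "\<forall>\<^sub>F n in sequentially. x n - (- a) \<in> S"
    by (auto simp: image_subset_iff add.commute)
  then show ?thesis
    unfolding convergent_in_def limitin_semigroup_topology_iff[OF S] by (rule exI)
qed

section \<open>Bounds for countable and for infinite subsets\<close>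

lemma countable_bounded_imp_diff_UNIV:
  fixes S :: "'a::ab_group_add set"
  assumes bdd: "\<forall>C :: 'a set. countable C \<longrightarrow> (\<exists>a\<in>S. C \<subseteq> elt_diff_alg a S)"
  shows "UNIV = set_diff_alg S S"
proof -
  have "g \<in> set_diff_alg S S" for g
  proof -
    obtain a where "a \<in> S" "a - g \<in> S"
      using bdd[rule_format, of "{g}"] by auto
    moreover have "g = a - (a - g)" by simp
    ultimately show ?thesis
      unfolding set_diff_alg_def by blast
  qed
  then show ?thesis by blast
qed

lemma countable_bounded_imp_infinite_Int:
  fixes S :: "'a::ab_group_add set"
  assumes bdd: "\<forall>C\<subseteq>S. countable C \<longrightarrow> (\<exists>a\<in>S. C \<subseteq> elt_diff_alg a S)"
    and C: "C \<subseteq> S" "infinite C"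
  shows "\<exists>a\<in>S. infinite (C \<inter> elt_diff_alg a S)"
proof -
  \<comment> \<open>\<open>C\<close> may be uncountable, so the bound is taken for a countably
    infinite part of it.\<close>
  obtain D where D: "D \<subseteq> C" "countable D" "infinite D"
    using infinite_countable_subset'[OF C(2)] by blast
  then obtain a where "a \<in> S" "D \<subseteq> elt_diff_alg a S"
    using bdd C by (meson subset_trans)
  then show ?thesis
    using D by (meson finite_subset Int_greatest)
qed

text \<open>Chooses for each group element a shift by an element of \<open>S\<close> that carries it
  into \<open>S\<close>; arbitrary sets can then be replaced by subsets of \<open>S\<close>.\<close>

lemma set_diff_alg_UNIV_witness:
  assumes "UNIV = set_diff_alg S S"
  obtains q where "\<And>c. q c \<in> S" "\<And>c. c + q c \<in> S"
proof -
  have "\<exists>t. t \<in> S \<and> c + t \<in> S" for c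
  proof -
    obtain s t where "c = s - t" "s \<in> S" "t \<in> S"
      using assms unfolding set_diff_alg_def by blast
    then show ?thesis
      by (intro exI[of _ t]) simp
  qed
  then show thesis
    using that by metis
qed

text \<open>Shift each \<open>c\<close> to \<open>c + q c\<close> in \<open>S\<close>. An element
  \<open>a\<close> whose difference with the shifted point lies in \<open>S\<close> serves for
  \<open>c\<close> too, because adding \<open>q c\<close> to that difference stays in
  \<open>S\<close>.\<close>

lemma infinite_Int_semigroup_imp_group:
  fixes S :: "'a::ab_group_add set"
  assumes S: "add_subsemigroup S" "UNIV = set_diff_alg S S"
    and inf: "\<forall>C\<subseteq>S. infinite C \<longrightarrow> (\<exists>a\<in>S. infinite (C \<inter> elt_diff_alg a S))"
    and C: "infinite C"
  shows "\<exists>a. infinite (C \<inter> elt_diff_alg a S)"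
proof -
  obtain q where q: "\<And>c. q c \<in> S" and p: "\<And>c. c + q c \<in> S"
    using set_diff_alg_UNIV_witness[OF S(2)] by blast
  define p where "p c = c + q c" for c
  have below: "a - c \<in> S" if "a - p c \<in> S" for a c
  proof -
    have "(a - p c) + q c \<in> S"
      using S(1) that q by (auto simp: add_subsemigroup_def)
    then show ?thesis
      by (simp add: p_def)
  qed
  show ?thesis
  proof (cases "finite (p ` C)")
    case True
    \<comment> \<open>The shifted set is too small for \<open>inf\<close>, but the common value
      \<open>p c0\<close> is itself a bound: \<open>p c0 - c = q c\<close> on this fibre.\<close>
    then obtain c0 where c0: "infinite {c \<in> C. p c = p c0}"
      using pigeonhole_infinite[OF C] by blast
    have "{c \<in> C. p c = p c0} \<subseteq> C \<inter> elt_diff_alg (p c0) S"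
    proof clarsimp
      fix c assume "p c = p c0"
      then have "p c0 - c = q c"
        by (metis p_def add_diff_cancel_left')
      then show "p c0 - c \<in> S"
        using q by simp
    qed
    then show ?thesis
      using c0 finite_subset by blast
  next
    case False
    moreover have "p ` C \<subseteq> S"
      using p by (auto simp: p_def)
    ultimately obtain a where a: "infinite (p ` C \<inter> elt_diff_alg a S)"
      using inf by blast
    have "p ` C \<inter> elt_diff_alg a S \<subseteq> p ` (C \<inter> elt_diff_alg a S)"
      using below by auto
    then show ?thesis
      using a finite_subset by blast
  qed
qed

lemma infinite_Int_imp_countable_bounded:
  fixes S :: "'a::ab_group_add set"
  assumes S: "add_subsemigroup S" "0 \<in> S" "UNIV = set_diff_alg S S"
    and inf: "\<forall>C :: 'a set. infinite C \<longrightarrow> (\<exists>a. infinite (C \<inter> elt_diff_alg a S))"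
    and C: "countable C"
  shows "\<exists>a\<in>S. C \<subseteq> elt_diff_alg a S"
proof -
  let ?D = "insert 0 C"
  obtain q where q: "\<And>c. q c \<in> S" and p: "\<And>c. c + q c \<in> S"
    using set_diff_alg_UNIV_witness[OF S(3)] by blast
  define c where "c n = from_nat_into ?D n" for n
  \<comment> \<open>The terms \<open>c i\<close> need not lie in \<open>S\<close>; the shifted
    summands do, so any of them can be added back to \<open>a - d n\<close> without leaving
    \<open>S\<close>.\<close>
  define d where "d n = (\<Sum>i\<le>n. c i + q (c i))" for n
  have add: "s + t \<in> S" if "s \<in> S" "t \<in> S" for s t
    using S(1) that by (auto simp: add_subsemigroup_def)
  have sum_S: "sum f A \<in> S" if "\<And>i. f i \<in> S" for f :: "nat \<Rightarrow> 'a" and A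
    using that by (induction A rule: infinite_finite_induct) (auto simp: S(2) add)
  have "\<exists>a. infinite {n. a - d n \<in> S}"
  \<comment> \<open>Infinitely many indices are needed, and \<open>d\<close> may repeat values. If
    its range is finite, a value taken infinitely often works as \<open>a\<close>, with difference
    0.\<close>
  proof (cases "finite (range d)")
    case True
    then obtain n0 where n0: "infinite {n \<in> UNIV. d n = d n0}"
      using pigeonhole_infinite[of UNIV d] by blast
    have "{n \<in> UNIV. d n = d n0} \<subseteq> {n. d n0 - d n \<in> S}"
      using S(2) by auto
    then show ?thesis
      using n0 finite_subset by blast
  next
    case False
    then obtain a where a: "infinite (range d \<inter> elt_diff_alg a S)"
      using inf by blast
    have "range d \<inter> elt_diff_alg a S \<subseteq> d ` {n. a - d n \<in> S}"
      by auto
    then show ?thesis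
      using a finite_subset by blast
  qed
  then obtain a where a: "infinite {n. a - d n \<in> S}"
    by blast
  have "a - x \<in> S" if x: "x \<in> ?D" for x
  proof -
    obtain i where i: "c i = x"
      using from_nat_into_surj[of ?D x] C x by (auto simp: c_def)
    obtain n where n: "i \<le> n" "a - d n \<in> S"
      using a unfolding infinite_nat_iff_unbounded_le by blast
    let ?r = "\<Sum>j\<in>{..n} - {i}. c j + q (c j)"
    have "d n = (x + q x) + ?r"
      using n(1) by (simp add: d_def sum.remove[of "{..n}" i] i)
    then have "a - x = (a - d n) + ?r + q x"
      by (simp add: algebra_simps)
    also have "\<dots> \<in> S"
      by (intro add n(2) q sum_S p)
    finally show ?thesis .
  qed
  \<comment> \<open>The element 0 adjoined in \<open>?D\<close> yields
    \<open>a \<in> S\<close>.\<close>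
  from this[of 0] this show ?thesis
    by (intro bexI[of _ a]) auto
qed

section \<open>Sequential compactness of powers\<close>

lemma all_convergent_imp_power_seq_compact:
  fixes I :: "'i set" and X :: "'a topology"
  assumes conv: "\<forall>x :: nat \<Rightarrow> 'a. convergent_in X x"
  shows "sequentially_compact_space (power_topology X I)"
  unfolding sequentially_compact_space_def
proof (intro allI impI exI conjI)
  fix x :: "nat \<Rightarrow> 'i \<Rightarrow> 'a"
  assume x: "range x \<subseteq> topspace (power_topology X I)"
  have "\<exists>l. limitin X (\<lambda>n. x n i) l sequentially" for i
    using conv by (auto simp: convergent_in_def)
  then obtain l where "\<And>i. limitin X (\<lambda>n. x n i) (l i) sequentially"
    by metis
  \<comment> \<open>Points of the product are extensional on \<open>I\<close>, hence the
    restriction.\<close>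
  then have "limitin (power_topology X I) x (restrict l I) sequentially"
    using x by (auto simp: power_topology_def limitin_componentwise image_subset_iff)
  then show "convergent_in (power_topology X I) (x \<circ> id)"
    by (auto simp: convergent_in_def)
qed (rule strict_mono_id)

lemma power_seq_compact_imp_convergent:
  fixes g :: "'i \<Rightarrow> nat set" and x :: "nat \<Rightarrow> 'a"
  assumes compact: "sequentially_compact_space (power_topology X I)"
    and g: "g ` I = UNIV"
    and x: "range x \<subseteq> topspace X"
  shows "convergent_in X x"
proof -
  \<comment> \<open>The cardinality counts the elements of \<open>g i\<close> below
    \<open>n\<close>; when \<open>n\<close> is the \<open>k\<close>-th element of
    \<open>g i\<close>, counted from 0, coordinate \<open>i\<close> is \<open>x k\<close>.\<close>
  define y where "y n = (\<lambda>i\<in>I. x (card (g i \<inter> {..<n})))" for n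
  have "range y \<subseteq> topspace (power_topology X I)"
    using x by (auto simp: y_def power_topology_def)
  then obtain r where r: "strict_mono r" and "convergent_in (power_topology X I) (y \<circ> r)"
    using compact unfolding sequentially_compact_space_def by blast
  then obtain l where l: "limitin (power_topology X I) (y \<circ> r) l sequentially"
    by (auto simp: convergent_in_def)
  \<comment> \<open>Surjectivity of \<open>g\<close> provides a coordinate adapted to whichever
    subsequence \<open>r\<close> arose.\<close>
  obtain i where i: "i \<in> I" "g i = range r"
    using g by (metis UNIV_I imageE)
  have "y (r k) i = x k" for k
  proof -
    have "range r \<inter> {..<r k} = r ` {..<k}"
      using r by (auto simp: strict_mono_less)
    then have "card (range r \<inter> {..<r k}) = k"
      using r by (simp add: card_image strict_mono_imp_inj_on inj_on_subset)
    then show ?thesis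
      using i by (simp add: y_def)
  qed
  moreover have "limitin X (\<lambda>k. (y \<circ> r) k i) (l i) sequentially"
    using l i(1) unfolding power_topology_def limitin_componentwise by blast
  ultimately show ?thesis
    by (auto simp: convergent_in_def)
qed

theorem proposition5p10:
  fixes S :: "'a::ab_group_add set"
  assumes "add_subsemigroup S" and "0 \<in> S"
  shows "all_equivalent
    [\<forall>x :: nat \<Rightarrow> 'a. convergent_in (semigroup_topology S) x,
     \<forall>I :: ('i + real) set. sequentially_compact_space (power_topology (semigroup_topology S) I),
     sequentially_compact_space (power_topology (semigroup_topology S) (UNIV :: real set)),
     \<forall>C :: 'a set. countable C \<longrightarrow> (\<exists>a\<in>S. C \<subseteq> elt_diff_alg a S),
     UNIV = set_diff_alg S S \<and>
       (\<forall>C\<subseteq>S. countable C \<longrightarrow> (\<exists>a\<in>S. C \<subseteq> elt_diff_alg a S)),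
     UNIV = set_diff_alg S S \<and>
       (\<forall>C\<subseteq>S. infinite C \<longrightarrow> (\<exists>a\<in>S. infinite (C \<inter> elt_diff_alg a S))),
     UNIV = set_diff_alg S S \<and>
       (\<forall>C :: 'a set. infinite C \<longrightarrow> (\<exists>a. infinite (C \<inter> elt_diff_alg a S)))]"
proof -
  let ?X = "semigroup_topology S"
  let ?conv = "\<forall>x :: nat \<Rightarrow> 'a. convergent_in ?X x"
  obtain g :: "real \<Rightarrow> nat set" where g: "range g = UNIV"
    using eqpoll_sym[OF nat_sets_eqpoll_reals] by (auto simp: eqpoll_def bij_betw_def)
  \<comment> \<open>The copy of the reals in \<open>'i + real\<close> is an exponent large enough to
    index all sets of naturals, whatever \<open>'i\<close> is.\<close>
  have "(g \<circ> projr) ` range (Inr :: real \<Rightarrow> 'i + real) = UNIV"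
    by (simp add: image_comp comp_def g)
  then have power: "(\<forall>I :: ('i + real) set. sequentially_compact_space (power_topology ?X I)) \<longleftrightarrow> ?conv"
    using power_seq_compact_imp_convergent[of ?X] all_convergent_imp_power_seq_compact[of ?X]
      topspace_semigroup_topology[OF assms] by (metis subset_UNIV)
  have power_real: "sequentially_compact_space (power_topology ?X (UNIV :: real set)) \<longleftrightarrow> ?conv"
    using power_seq_compact_imp_convergent[OF _ g, of ?X] all_convergent_imp_power_seq_compact[of ?X]
      topspace_semigroup_topology[OF assms] by (metis subset_UNIV)
  let ?P4 = "\<forall>C :: 'a set. countable C \<longrightarrow> (\<exists>a\<in>S. C \<subseteq> elt_diff_alg a S)"
  let ?P5 = "UNIV = set_diff_alg S S \<and>
    (\<forall>C\<subseteq>S. countable C \<longrightarrow> (\<exists>a\<in>S. C \<subseteq> elt_diff_alg a S))"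
  let ?P6 = "UNIV = set_diff_alg S S \<and>
    (\<forall>C\<subseteq>S. infinite C \<longrightarrow> (\<exists>a\<in>S. infinite (C \<inter> elt_diff_alg a S)))"
  let ?P7 = "UNIV = set_diff_alg S S \<and>
    (\<forall>C :: 'a set. infinite C \<longrightarrow> (\<exists>a. infinite (C \<inter> elt_diff_alg a S)))"
  have P4: "?P4 \<longleftrightarrow> ?conv"
    using all_convergent_imp_countable_bounded[OF assms] countable_bounded_imp_convergent[OF assms]
    by blast
  have P45: ?P5 if ?P4
    using countable_bounded_imp_diff_UNIV[OF that] that by simp
  have P56: ?P6 if ?P5
    using countable_bounded_imp_infinite_Int[of S] that by simp
  have P67: ?P7 if ?P6
    using infinite_Int_semigroup_imp_group[OF assms(1)] that by simp
  have P74: ?P4 if ?P7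
    using infinite_Int_imp_countable_bounded[OF assms] that by simp
  have P567: "?P5 \<longleftrightarrow> ?P4" "?P6 \<longleftrightarrow> ?P4" "?P7 \<longleftrightarrow> ?P4"
    using P45 P56 P67 P74 by satx+
  show ?thesis
    unfolding P567 P4 power power_real by (simp add: all_equivalent_def)
qed

end
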